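(* Let $(X,\|\cdot\|)$ be a complex Banach space with open unit ball $B$, let $\omega\in\mathbb{R}$, and let $D\subset B$ be dense in $B$ and balanced. Let $h:D\to X$ be an $\omega$-pseudo-contractive map which is closed in the weak topology. Assume that either $X$ is reflexive, or $X$ is weakly sequentially complete and $h$ is bounded on every set $K(x):=\{\zeta x:\zeta\in\mathbb{C},\ |\zeta|<1\}$, $x\in D$. Then $h$ is $\omega$-dissipative.
   Context: $X$ is a complex Banach space, $X^*$ its dual, $\langle x,x^*\rangle$ the value of $x^*\in X^*$ at $x\in X$, $B=\{x\in X:\|x\|<1\}$, and $J(x)=\{x^*\in X^*:\|x\|^2=\langle x,x^*\rangle=\|x^*\|^2\}$. A set $C\subset X$ is balanced if $\zeta x\in C$ for all $x\in C$ and all $\zeta\in\mathbb{C}$ with $|\zeta|\le 1$. A domain is an open connected subset of $X$; a map from a domain $V$ into $W\subseteq X$ is holomorphic, written as an element of $\mathrm{Hol}(V,W)$, if it is (complex) Fréchet differentiable at each point of $V$ (as a map into $X$). Abel average: for $h:D\subset B\to X$ and real $\omega,\alpha$ with $\alpha\omega\neq1$, $\Phi_\alpha=(I-\alpha h)^{-1}\circ[(1-\alpha\omega)I]$, $\Phi_0=I$, where $I$ is the identity. That is, $\Phi_\alpha(x)$ is the unique $y\in D$ with $y-\alpha h(y)=(1-\alpha\omega)x$; "$\Phi_\alpha\in\mathrm{Hol}(B,D)$" means that such a unique $y$ exists for every $x\in B$ and that $x\mapsto y$ is holomorphic on $B$. The map $h:D\to X$ is $\omega$-pseudo-contractive if there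 exists $\delta>0$ such that $\Phi_\alpha\in\mathrm{Hol}(B,D)$ for each $\alpha\in(0,\delta)$. For $D$ dense in $B$, the map $h:D\to X$ is $\omega$-dissipative if there are $\varepsilon>0$ and $\varsigma\in\mathbb{R}$ such that for each $x\in D$ with $1-\varepsilon<\|x\|<1$ and all $x^*\in J(x)$: $\mathrm{Re}\langle h(x),x^*\rangle\le\omega\|x\|^2+\varsigma(1-\|x\|^2)$. The map $h:D\to X$ is closed in the weak topology if, for each norm-convergent sequence $\{x_n\}\subset D$ with $\lim x_n=x\in D$ such that $\{h(x_n)\}$ converges weakly to some $y\in X$, one has $h(x)=y$. *)

theory Defs
  imports "HOL-Analysis.Analysis"
begin

class complex_normed_vector = real_normed_vector +
  fixes scaleC :: "complex \<Rightarrow> 'a \<Rightarrow> 'a" (infixr "*\<^sub>C" 75)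
  assumes scaleC_add_right: "a *\<^sub>C (x + y) = a *\<^sub>C x + a *\<^sub>C y"
    and scaleC_add_left: "(a + b) *\<^sub>C x = a *\<^sub>C x + b *\<^sub>C x"
    and scaleC_scaleC: "a *\<^sub>C b *\<^sub>C x = (a * b) *\<^sub>C x"
    and scaleC_of_real: "complex_of_real r *\<^sub>C x = r *\<^sub>R x"
    and norm_scaleC: "norm (a *\<^sub>C x) = cmod a * norm x"

class complex_banach = complex_normed_vector + banach

instantiation complex :: complex_banach
begin

definition scaleC_complex :: "complex \<Rightarrow> complex \<Rightarrow> complex"
  where "scaleC_complex a x = a * x"

instance
  by standard
    (simp_all add: scaleC_complex_def algebra_simps norm_mult scaleR_conv_of_real)

end

definition bounded_clinear :: "('a::complex_normed_vector \<Rightarrow> 'b::complex_normed_vector) \<Rightarrow> bool"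
  where "bounded_clinear f \<longleftrightarrow> bounded_linear f \<and> (\<forall>c x. f (c *\<^sub>C x) = c *\<^sub>C f x)"

text \<open>The topological dual, normed by the operator norm, so that the bidual is
  \<open>'a dual dual\<close>.\<close>

typedef (overloaded) 'a dual = "{f :: 'a::complex_normed_vector \<Rightarrow> complex. bounded_clinear f}"
  morphisms dual_apply Abs_dual
  by (rule exI[of _ "\<lambda>_. 0"]) (simp add: bounded_clinear_def scaleC_complex_def)

setup_lifting type_definition_dual

lemma bounded_clinear_dual_apply: "bounded_clinear (dual_apply f)"
  using dual_apply[of f] by simp

lemma bounded_linear_dual_apply: "bounded_linear (dual_apply f)"
  using bounded_clinear_dual_apply[of f] by (simp add: bounded_clinear_def)

instantiation dual :: (complex_normed_vector) complex_normed_vector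
begin

lift_definition zero_dual :: "'a dual" is "\<lambda>_. 0"
  by (simp add: bounded_clinear_def scaleC_complex_def)

lift_definition plus_dual :: "'a dual \<Rightarrow> 'a dual \<Rightarrow> 'a dual" is "\<lambda>f g x. f x + g x"
  by (simp add: bounded_clinear_def scaleC_complex_def bounded_linear_add algebra_simps)

lift_definition uminus_dual :: "'a dual \<Rightarrow> 'a dual" is "\<lambda>f x. - f x"
  by (simp add: bounded_clinear_def scaleC_complex_def bounded_linear_minus)

lift_definition minus_dual :: "'a dual \<Rightarrow> 'a dual \<Rightarrow> 'a dual" is "\<lambda>f g x. f x - g x"
  by (simp add: bounded_clinear_def scaleC_complex_def bounded_linear_sub algebra_simps)

lift_definition scaleR_dual :: "real \<Rightarrow> 'a dual \<Rightarrow> 'a dual" is "\<lambda>r f x. r *\<^sub>R f x"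
  by (simp add: bounded_clinear_def scaleC_complex_def bounded_linear_const_scaleR)

lift_definition scaleC_dual :: "complex \<Rightarrow> 'a dual \<Rightarrow> 'a dual" is "\<lambda>c f x. c *\<^sub>C f x"
  by (simp add: bounded_clinear_def scaleC_complex_def bounded_linear_const_mult)

lift_definition norm_dual :: "'a dual \<Rightarrow> real" is onorm .

definition dist_dual :: "'a dual \<Rightarrow> 'a dual \<Rightarrow> real"
  where "dist_dual f g = norm (f - g)"

definition sgn_dual :: "'a dual \<Rightarrow> 'a dual"
  where "sgn_dual f = inverse (norm f) *\<^sub>R f"

definition uniformity_dual :: "('a dual \<times> 'a dual) filter"
  where "uniformity_dual = (INF e\<in>{0<..}. principal {(f, g). dist f g < e})"

definition open_dual :: "'a dual set \<Rightarrow> bool"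
  where "open_dual U = (\<forall>f\<in>U. \<forall>\<^sub>F (f', g) in uniformity. f' = f \<longrightarrow> g \<in> U)"

instance
proof
  fix f g h :: "'a dual" and r s :: real and a b :: complex and U :: "'a dual set"
  show "f + g + h = f + (g + h)" by transfer (simp add: add.assoc)
  show "f + g = g + f" by transfer (simp add: add.commute)
  show "0 + f = f" by transfer simp
  show "- f + f = 0" by transfer simp
  show "f - g = f + - g" by transfer simp
  show "r *\<^sub>R (f + g) = r *\<^sub>R f + r *\<^sub>R g" by transfer (simp add: scaleR_add_right)
  show "(r + s) *\<^sub>R f = r *\<^sub>R f + s *\<^sub>R f" by transfer (simp add: scaleR_add_left)
  show "r *\<^sub>R s *\<^sub>R f = (r * s) *\<^sub>R f" by transfer simp
  show "1 *\<^sub>R f = f" by transfer simp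
  show "dist f g = norm (f - g)" by (rule dist_dual_def)
  show "sgn f = inverse (norm f) *\<^sub>R f" by (rule sgn_dual_def)
  show "uniformity = (INF e\<in>{0<..}. principal {(f :: 'a dual, g). dist f g < e})"
    by (rule uniformity_dual_def)
  show "open U = (\<forall>f\<in>U. \<forall>\<^sub>F (f', g) in uniformity. f' = f \<longrightarrow> g \<in> U)"
    by (rule open_dual_def)
  show "(norm f = 0) = (f = 0)"
    by transfer (auto simp: bounded_clinear_def onorm_eq_0)
  show "norm (f + g) \<le> norm f + norm g"
    by transfer (simp add: bounded_clinear_def onorm_triangle)
  show "norm (r *\<^sub>R f) = \<bar>r\<bar> * norm f"
    by transfer (simp add: bounded_clinear_def onorm_scaleR)
  show "a *\<^sub>C (f + g) = a *\<^sub>C f + a *\<^sub>C g" by transfer (simp add: scaleC_add_right)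
  show "(a + b) *\<^sub>C f = a *\<^sub>C f + b *\<^sub>C f" by transfer (simp add: scaleC_add_left)
  show "a *\<^sub>C b *\<^sub>C f = (a * b) *\<^sub>C f" by transfer (simp add: scaleC_scaleC)
  show "complex_of_real r *\<^sub>C f = r *\<^sub>R f" by transfer (simp add: scaleC_of_real)
  have "onorm (\<lambda>x. a *\<^sub>C k x) = onorm (\<lambda>x. cmod a *\<^sub>R k x)" for k :: "'a \<Rightarrow> complex"
    by (simp add: onorm_def norm_scaleC)
  then show "norm (a *\<^sub>C f) = cmod a * norm f"
    by transfer (simp add: bounded_clinear_def onorm_scaleR)
qed

end

lemma norm_dual_apply_le: "norm (dual_apply f x) \<le> norm f * norm x"
  by (simp add: norm_dual.rep_eq onorm[OF bounded_linear_dual_apply])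

lift_definition bidual_embedding :: "'a::complex_normed_vector \<Rightarrow> 'a dual dual"
  is "\<lambda>x f. dual_apply f x"
proof -
  fix x :: 'a
  have "bounded_linear (\<lambda>f. dual_apply f x)"
    by (rule bounded_linear_intro[of _ "norm x"])
      (simp_all add: plus_dual.rep_eq scaleR_dual.rep_eq norm_dual_apply_le)
  then show "bounded_clinear (\<lambda>f. dual_apply f x)"
    by (simp add: bounded_clinear_def scaleC_dual.rep_eq)
qed

definition reflexive_space :: "'a::complex_normed_vector itself \<Rightarrow> bool"
  where "reflexive_space _ \<longleftrightarrow> surj (bidual_embedding :: 'a \<Rightarrow> 'a dual dual)"

definition weakly_converges :: "(nat \<Rightarrow> 'a::complex_normed_vector) \<Rightarrow> 'a \<Rightarrow> bool"
  where "weakly_converges u y \<longleftrightarrow> (\<forall>f. (\<lambda>n. dual_apply f (u n)) \<longlonglongrightarrow> dual_apply f y)"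

definition weakly_Cauchy :: "(nat \<Rightarrow> 'a::complex_normed_vector) \<Rightarrow> bool"
  where "weakly_Cauchy u \<longleftrightarrow> (\<forall>f. Cauchy (\<lambda>n. dual_apply f (u n)))"

definition weakly_sequentially_complete :: "'a::complex_normed_vector itself \<Rightarrow> bool"
  where "weakly_sequentially_complete _ \<longleftrightarrow>
    (\<forall>u :: nat \<Rightarrow> 'a. weakly_Cauchy u \<longrightarrow> (\<exists>y. weakly_converges u y))"

definition balanced :: "'a::complex_normed_vector set \<Rightarrow> bool"
  where "balanced C \<longleftrightarrow> (\<forall>x\<in>C. \<forall>\<zeta>. cmod \<zeta> \<le> 1 \<longrightarrow> \<zeta> *\<^sub>C x \<in> C)"

definition duality_map :: "'a::complex_normed_vector \<Rightarrow> 'a dual set"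
  where "duality_map x = {f. complex_of_real ((norm x)\<^sup>2) = dual_apply f x
    \<and> dual_apply f x = complex_of_real ((norm f)\<^sup>2)}"

text \<open>To be used for open \<open>V\<close> only: the derivative is taken with respect to a full
  neighbourhood of the point.\<close>

definition Hol :: "'a::complex_normed_vector set \<Rightarrow> 'a set \<Rightarrow> ('a \<Rightarrow> 'a) set"
  where "Hol V W = {F. F ` V \<subseteq> W \<and>
    (\<forall>x\<in>V. \<exists>F'. bounded_clinear F' \<and> (F has_derivative F') (at x))}"

text \<open>A map \<open>D \<rightarrow> X\<close> is represented by a total function whose values outside \<open>D\<close> are
  irrelevant. For \<open>\<alpha> \<noteq> 0\<close> the value of \<open>abel_average\<close> at \<open>x\<close> is meaningful only if the
  solution \<open>y\<close> exists and is unique, which \<open>pseudo_contractive\<close> therefore demands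
  explicitly.\<close>

definition abel_solution ::
    "'a::complex_normed_vector set \<Rightarrow> ('a \<Rightarrow> 'a) \<Rightarrow> real \<Rightarrow> real \<Rightarrow> 'a \<Rightarrow> 'a \<Rightarrow> bool"
  where "abel_solution D h \<omega> \<alpha> x y \<longleftrightarrow> y \<in> D \<and> y - \<alpha> *\<^sub>R h y = (1 - \<alpha> * \<omega>) *\<^sub>R x"

definition abel_average ::
    "'a::complex_normed_vector set \<Rightarrow> ('a \<Rightarrow> 'a) \<Rightarrow> real \<Rightarrow> real \<Rightarrow> 'a \<Rightarrow> 'a"
  where "abel_average D h \<omega> \<alpha> x = (if \<alpha> = 0 then x else (THE y. abel_solution D h \<omega> \<alpha> x y))"

definition pseudo_contractive ::
    "real \<Rightarrow> 'a::complex_normed_vector set \<Rightarrow> ('a \<Rightarrow> 'a) \<Rightarrow> bool"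
  where "pseudo_contractive \<omega> D h \<longleftrightarrow>
    (\<exists>\<delta>>0. \<forall>\<alpha>\<in>{0<..<\<delta>}. \<alpha> * \<omega> \<noteq> 1 \<and>
      (\<forall>x\<in>ball 0 1. \<exists>!y. abel_solution D h \<omega> \<alpha> x y) \<and>
      abel_average D h \<omega> \<alpha> \<in> Hol (ball 0 1) D)"

definition dissipative ::
    "real \<Rightarrow> 'a::complex_normed_vector set \<Rightarrow> ('a \<Rightarrow> 'a) \<Rightarrow> bool"
  where "dissipative \<omega> D h \<longleftrightarrow>
    (\<exists>\<epsilon>>0. \<exists>\<sigma>. \<forall>x\<in>D. 1 - \<epsilon> < norm x \<and> norm x < 1 \<longrightarrow>
      (\<forall>f\<in>duality_map x.
        Re (dual_apply f (h x)) \<le> \<omega> * (norm x)\<^sup>2 + \<sigma> * (1 - (norm x)\<^sup>2)))"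

definition weakly_closed_map :: "'a::complex_normed_vector set \<Rightarrow> ('a \<Rightarrow> 'a) \<Rightarrow> bool"
  where "weakly_closed_map D h \<longleftrightarrow>
    (\<forall>u x y. range u \<subseteq> D \<longrightarrow> u \<longlonglongrightarrow> x \<longrightarrow> x \<in> D \<longrightarrow>
      weakly_converges (\<lambda>n. h (u n)) y \<longrightarrow> h x = y)"

end

theory Submission
  imports Defs "HOL-Complex_Analysis.Riemann_Mapping"
begin

(* Write g(x) = \<omega>x - h(x) and s = \<alpha>/(1 - \<alpha>\<omega>). The Abel average F_s = \<Phi>_\<alpha> satisfies
   F_s(x + s g(x)) = x for x in D and s small. For a functional f, the scalar functions f o F_s are
   uniformly bounded and holomorphic, hence locally equi-Lipschitz by the Schwarz lemma; therefore
   f(F_s(p)) - f(p) = f(F_s(p)) - f(F_s(p + s g(p))) -> 0 on D, and by density uniformly on compact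
   subsets of B. The Schwarz lemma applied to f o F_s - f along the complex line x + \<zeta> g(x) then gives
   (f(x) - f(F_s(x))) / s -> f(g(x)). On the other hand, for f in J(x) the Schwarz-Pick inequality
   bounds Re f(F_s(x)) by |x|^2 + 2 s |h(0)| (1 - |x|^2), and comparing the two yields dissipativity
   with constant 2 |h(0)|. *)

section \<open>Schwarz and Schwarz-Pick estimates on the disc\<close>

text \<open>The rescaled map \<open>(g (r z) - g 0) / (2 M)\<close> fixes 0 and sends the unit disc
  into itself, so the Schwarz lemma applies to it.\<close>

lemma Schwarz_diff_bound:
  assumes hol: "g holomorphic_on ball 0 r"
    and bd: "\<And>z. norm z < r \<Longrightarrow> norm (g z) < M"
    and s: "norm s < r"
  shows "norm (g s - g 0) \<le> 2 * M * norm s / r"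
proof -
  have r: "r > 0" using s norm_ge_zero[of s] by linarith
  have M: "M > 0" using bd[OF s] norm_ge_zero[of "g s"] by linarith
  define k where "k z = (g (of_real r * z) - g 0) / of_real (2 * M)" for z
  have inr: "norm (of_real r * z) < r" if "norm z < 1" for z :: complex
    using that r by (simp add: norm_mult)
  have "k holomorphic_on ball 0 1"
    unfolding k_def
    by (intro holomorphic_intros holomorphic_on_compose_gen[OF _ hol, unfolded o_def])
      (use inr M in auto)
  moreover have "norm (k z) < 1" if "norm z < 1" for z
  proof -
    have "norm (g (of_real r * z) - g 0) < 2 * M"
      using norm_triangle_ineq4[of "g (of_real r * z)" "g 0"] bd[OF inr[OF that]] bd[of 0] r by simp
    then show ?thesis using M by (simp add: k_def norm_divide norm_mult)
  qed
  ultimately have "norm (k (s / of_real r)) \<le> norm (s / of_real r)"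
    using Schwarz_Lemma(1)[of k "s / of_real r"] s r by (simp add: k_def norm_divide)
  then show ?thesis
    using r M by (simp add: k_def norm_divide norm_mult field_simps)
qed

text \<open>After composition with the Moebius map sending \<open>g 0\<close> to 0 the Schwarz lemma
  applies. The resulting inequality is weakened to one linear in \<open>norm (g 0)\<close>, the form
  needed for a comparison of first order in s.\<close>

lemma Schwarz_Pick_norm_bound:
  assumes hol: "g holomorphic_on ball 0 1"
    and bd: "\<And>z. norm z < 1 \<Longrightarrow> norm (g z) < 1"
    and z: "norm z < 1"
  shows "(norm (g z))\<^sup>2 \<le> (norm z)\<^sup>2 + 2 * norm (g 0) * (1 - (norm z)\<^sup>2)"
proof -
  define c where "c = g 0"
  define w where "w = g z"
  define m where "m = norm c"
  have c: "norm c < 1" unfolding c_def by (rule bd) simp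
  then have m: "0 \<le> m" "m < 1" by (auto simp: m_def)
  have r: "(norm z)\<^sup>2 \<le> 1" using z by (simp add: abs_square_le_1)
  have "norm (Moebius_function 0 c (g z)) \<le> norm z"
  proof (rule Schwarz_Lemma(1)[of "\<lambda>z. Moebius_function 0 c (g z)"])
    show "(\<lambda>z. Moebius_function 0 c (g z)) holomorphic_on ball 0 1"
      using holomorphic_on_compose_gen[OF hol Moebius_function_holomorphic[OF c]] bd
      by (auto simp: o_def image_subset_iff)
  qed (use c bd z in \<open>auto simp: c_def Moebius_function_eq_zero Moebius_function_norm_lt_1\<close>)
  then have T: "norm (w - c) / norm (1 - cnj c * w) \<le> norm z"
    by (simp add: Moebius_function_simple norm_divide w_def)
  have low: "1 - m \<le> norm (1 - cnj c * w)"
  proof -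
    have "norm (cnj c * w) \<le> m"
      using bd[OF z] by (simp add: norm_mult m_def w_def mult_left_le)
    then show ?thesis using norm_triangle_ineq2[of 1 "cnj c * w"] by simp
  qed
  then have "norm (w - c) \<le> norm z * norm (1 - cnj c * w)"
    using T m by (subst (asm) pos_divide_le_eq) auto
  then have "(norm (w - c))\<^sup>2 \<le> (norm z)\<^sup>2 * (norm (1 - cnj c * w))\<^sup>2"
    by (metis norm_ge_zero power_mono power_mult_distrib)
  \<comment> \<open>The identity behind the fact that Moebius maps preserve the disc; it turns the
    Schwarz bound into a comparison of \<open>1 - (norm z)^2\<close> with
    \<open>1 - (norm w)^2\<close>.\<close>
  moreover have "(norm (1 - cnj c * w))\<^sup>2 - (norm (w - c))\<^sup>2 = (1 - (norm w)\<^sup>2) * (1 - m\<^sup>2)"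
    unfolding m_def cmod_power2 by (simp add: algebra_simps power2_eq_square)
  ultimately have "(1 - (norm z)\<^sup>2) * (norm (1 - cnj c * w))\<^sup>2 \<le> (1 - (norm w)\<^sup>2) * (1 - m\<^sup>2)"
    by (simp add: algebra_simps)
  moreover have "(1 - (norm z)\<^sup>2) * (1 - m)\<^sup>2 \<le> (1 - (norm z)\<^sup>2) * (norm (1 - cnj c * w))\<^sup>2"
    using low m r by (intro mult_left_mono power_mono) auto
  ultimately have "(1 - m) * ((1 - (norm z)\<^sup>2) * (1 - m)) \<le> (1 - m) * ((1 - (norm w)\<^sup>2) * (1 + m))"
    by (simp add: algebra_simps power2_eq_square)
  then have "(1 - (norm z)\<^sup>2) * (1 - m) \<le> (1 - (norm w)\<^sup>2) * (1 + m)"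
    using m by simp
  \<comment> \<open>Here \<open>(1 - 2 m) (1 + m) = 1 - m - 2 m^2 <= 1 - m\<close>, that is,
    \<open>(1 - m) / (1 + m) >= 1 - 2 m\<close> without denominators.\<close>
  moreover have "(1 - (norm z)\<^sup>2) * ((1 - 2 * m) * (1 + m)) \<le> (1 - (norm z)\<^sup>2) * (1 - m)"
    using r m by (intro mult_left_mono) (auto simp: algebra_simps)
  ultimately have "((1 - (norm z)\<^sup>2) * (1 - 2 * m)) * (1 + m) \<le> (1 - (norm w)\<^sup>2) * (1 + m)"
    by (simp add: mult.assoc)
  then have "(1 - (norm z)\<^sup>2) * (1 - 2 * m) \<le> 1 - (norm w)\<^sup>2"
    using m by (simp add: mult_le_cancel_right)
  then show ?thesis by (simp add: w_def m_def c_def algebra_simps)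
qed

section \<open>Functionals and holomorphy along complex lines\<close>

lemma dual_apply_add: "dual_apply f (x + y) = dual_apply f x + dual_apply f y"
  by (rule linear_add[OF bounded_linear.linear[OF bounded_linear_dual_apply]])

lemma dual_apply_diff: "dual_apply f (x - y) = dual_apply f x - dual_apply f y"
  by (rule linear_diff[OF bounded_linear.linear[OF bounded_linear_dual_apply]])

lemma dual_apply_scaleC: "dual_apply f (c *\<^sub>C x) = c * dual_apply f x"
  using bounded_clinear_dual_apply[of f] by (simp add: bounded_clinear_def scaleC_complex_def)

lemma dual_apply_zero [simp]: "dual_apply f 0 = 0"
  by (rule linear_0[OF bounded_linear.linear[OF bounded_linear_dual_apply]])

lemma bounded_linear_scaleC_left: "bounded_linear (\<lambda>c. c *\<^sub>C (u::'a::complex_normed_vector))"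
proof (rule bounded_linear_intro[of _ "norm u"])
  show "(r *\<^sub>R c) *\<^sub>C u = r *\<^sub>R c *\<^sub>C u" for r c
    by (metis scaleC_of_real scaleC_scaleC scaleR_conv_of_real)
qed (simp_all add: scaleC_add_left norm_scaleC)

lemma scaleC_zero_left [simp]: "0 *\<^sub>C (u::'a::complex_normed_vector) = 0"
  using scaleC_of_real[of 0 u] by simp

lemma Hol_mono: "F \<in> Hol V W \<Longrightarrow> W \<subseteq> W' \<Longrightarrow> F \<in> Hol V W'"
  unfolding Hol_def by blast

text \<open>Reduction to one complex variable: complex homogeneity of \<open>F'\<close> turns the
  real derivative along the line into a complex one, with value
  \<open>dual_apply f (F' u)\<close>.\<close>

lemma Hol_along_line:
  assumes F: "F \<in> Hol V W" and sub: "\<And>\<zeta>. \<zeta> \<in> S \<Longrightarrow> a + \<zeta> *\<^sub>C u \<in> V"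
  shows "(\<lambda>\<zeta>. dual_apply f (F (a + \<zeta> *\<^sub>C u))) holomorphic_on S"
proof (rule holomorphic_onI)
  fix \<zeta> assume "\<zeta> \<in> S"
  with F sub obtain F' where F': "bounded_clinear F'" "(F has_derivative F') (at (a + \<zeta> *\<^sub>C u))"
    unfolding Hol_def by blast
  have "((\<lambda>\<zeta>. a + \<zeta> *\<^sub>C u) has_derivative (\<lambda>t. t *\<^sub>C u)) (at \<zeta>)"
    by (auto intro!: derivative_eq_intros bounded_linear.has_derivative[OF bounded_linear_scaleC_left])
  from bounded_linear.has_derivative[OF bounded_linear_dual_apply has_derivative_compose[OF this F'(2)]]
  have "((\<lambda>\<zeta>. dual_apply f (F (a + \<zeta> *\<^sub>C u))) has_derivative
      (\<lambda>t. dual_apply f (F' (t *\<^sub>C u)))) (at \<zeta>)" .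
  then have "((\<lambda>\<zeta>. dual_apply f (F (a + \<zeta> *\<^sub>C u))) has_field_derivative dual_apply f (F' u)) (at \<zeta>)"
    by (rule has_derivative_imp_has_field_derivative)
      (use F'(1) in \<open>simp add: bounded_clinear_def dual_apply_scaleC\<close>)
  then show "(\<lambda>\<zeta>. dual_apply f (F (a + \<zeta> *\<^sub>C u))) field_differentiable at \<zeta> within S"
    using field_differentiable_at_within field_differentiable_def by blast
qed

lemma dual_apply_ball_less:
  assumes "norm f > 0" "norm y < 1"
  shows "norm (dual_apply f y) < norm f"
proof -
  have "norm f * norm y < norm f * 1"
    using assms by (intro mult_strict_left_mono)
  then show ?thesis using norm_dual_apply_le[of f y] by simp
qed

section \<open>Holomorphic self-maps of the ball\<close>

lemma Hol_ball_norm_less: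
  assumes "F \<in> Hol (ball 0 1) (ball 0 1)" "norm x < 1"
  shows "norm (F x) < 1"
proof -
  have "F x \<in> ball 0 1" using assms unfolding Hol_def by (blast intro: mem_ball_0[THEN iffD2])
  then show ?thesis by simp
qed

text \<open>The disc of radius \<open>1 - norm a\<close> about \<open>a\<close> in the complex line
  through \<open>a\<close> and \<open>b\<close> stays in the ball, so
  \<open>Schwarz_diff_bound\<close> applies if \<open>b\<close> lies in it; otherwise the trivial
  bound \<open>2 * norm f\<close> suffices. The constant does not depend on \<open>F\<close>, which
  makes families of self-maps equi-Lipschitz.\<close>

lemma Hol_ball_lipschitz:
  fixes F :: "'a::complex_normed_vector \<Rightarrow> 'a"
  assumes F: "F \<in> Hol (ball 0 1) (ball 0 1)" and f: "norm f > 0"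
    and a: "norm a < 1" and b: "norm b < 1"
  shows "norm (dual_apply f (F b) - dual_apply f (F a)) \<le> 2 * norm f * norm (b - a) / (1 - norm a)"
proof (cases "norm (b - a) < 1 - norm a")
  case False
  have "norm (dual_apply f (F x)) < norm f" if "norm x < 1" for x
    by (intro dual_apply_ball_less f Hol_ball_norm_less[OF F] that)
  from this[OF a] this[OF b]
  have "norm (dual_apply f (F b) - dual_apply f (F a)) \<le> 2 * norm f"
    using norm_triangle_ineq4[of "dual_apply f (F b)" "dual_apply f (F a)"] by simp
  also have "\<dots> \<le> 2 * norm f * (norm (b - a) / (1 - norm a))"
    using mult_left_mono[of 1 "norm (b - a) / (1 - norm a)" "2 * norm f"] False a by simp
  finally show ?thesis by simp
next
  case True
  show ?thesis
  proof (cases "b = a")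
    case False
    define n where "n = norm (b - a)"
    have n: "n > 0" using False by (simp add: n_def)
    define u where "u = inverse n *\<^sub>R (b - a)"
    have u: "norm u = 1" using n by (simp add: u_def n_def)
    have inb: "norm (a + \<zeta> *\<^sub>C u) < 1" if "norm \<zeta> < 1 - norm a" for \<zeta>
      using that norm_triangle_ineq[of a "\<zeta> *\<^sub>C u"] u by (simp add: norm_scaleC)
    have "norm (dual_apply f (F (a + of_real n *\<^sub>C u)) - dual_apply f (F (a + 0 *\<^sub>C u)))
        \<le> 2 * norm f * norm (complex_of_real n) / (1 - norm a)"
    proof (rule Schwarz_diff_bound)
      show "(\<lambda>\<zeta>. dual_apply f (F (a + \<zeta> *\<^sub>C u))) holomorphic_on ball 0 (1 - norm a)"
        by (rule Hol_along_line[OF F]) (use inb in auto)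
      show "norm (dual_apply f (F (a + \<zeta> *\<^sub>C u))) < norm f" if "norm \<zeta> < 1 - norm a" for \<zeta>
        by (intro dual_apply_ball_less f Hol_ball_norm_less[OF F] inb that)
    qed (use True n in \<open>simp add: n_def\<close>)
    moreover have "of_real n *\<^sub>C u = b - a"
      using n by (simp add: scaleC_of_real u_def)
    ultimately show ?thesis using n by (simp add: n_def)
  qed simp
qed

text \<open>Since \<open>norm f = norm x\<close>, restricting \<open>F\<close> to the complex line
  through \<open>x\<close>, applying \<open>f\<close> and dividing by \<open>norm x\<close> gives a
  self-map of the disc. Schwarz-Pick bounds it, and the zero \<open>y\<close> of \<open>F\<close>
  controls its value at 0.\<close>

lemma Hol_ball_duality_bound:
  fixes F :: "'a::complex_normed_vector \<Rightarrow> 'a"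
  assumes F: "F \<in> Hol (ball 0 1) (ball 0 1)" and f: "f \<in> duality_map x"
    and x: "x \<noteq> 0" "norm x < 1" and y: "norm y < 1" "F y = 0"
  shows "Re (dual_apply f (F x)) \<le> (norm x)\<^sup>2 + 2 * norm y * (1 - (norm x)\<^sup>2)"
proof -
  define r where "r = norm x"
  have r: "0 < r" "r < 1" using x by (auto simp: r_def)
  have "complex_of_real ((norm x)\<^sup>2) = complex_of_real ((norm f)\<^sup>2)"
    using f unfolding duality_map_def by auto
  then have "r\<^sup>2 = (norm f)\<^sup>2" unfolding of_real_eq_iff r_def .
  then have nf: "norm f = r" using r by (metis norm_ge_zero order_less_imp_le power2_eq_imp_eq)
  define u where "u = inverse r *\<^sub>R x"
  have u: "norm u = 1" using r by (simp add: u_def r_def)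
  define g where "g \<zeta> = dual_apply f (F (0 + \<zeta> *\<^sub>C u)) / of_real r" for \<zeta>
  have inb: "norm (0 + \<zeta> *\<^sub>C u) < 1" if "norm \<zeta> < 1" for \<zeta>
    using that u by (simp add: norm_scaleC)
  have hol: "g holomorphic_on ball 0 1"
    unfolding g_def
    by (intro holomorphic_on_divide Hol_along_line[OF F] holomorphic_on_const) (use inb r in auto)
  have bd: "norm (g \<zeta>) < 1" if "norm \<zeta> < 1" for \<zeta>
  proof -
    have "norm (dual_apply f (F (0 + \<zeta> *\<^sub>C u))) < norm f"
      using r nf by (intro dual_apply_ball_less Hol_ball_norm_less[OF F] inb that) simp
    then show ?thesis using r nf by (simp add: g_def norm_divide)
  qed
  have ru: "of_real r *\<^sub>C u = x" using r by (simp add: scaleC_of_real u_def)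
  have g0: "norm (g 0) \<le> 2 * norm y"
  proof -
    have "norm (dual_apply f (F y) - dual_apply f (F 0)) \<le> 2 * r * norm y"
      using Hol_ball_lipschitz[OF F _ _ y(1), of f 0] r nf by simp
    then show ?thesis using r y by (simp add: g_def norm_divide field_simps)
  qed
  define w where "w = norm (g (of_real r))"
  have "w\<^sup>2 \<le> r\<^sup>2 + 2 * norm (g 0) * (1 - r\<^sup>2)"
    using Schwarz_Pick_norm_bound[OF hol bd, of "of_real r"] r by (simp add: w_def)
  moreover have "norm (g 0) * (1 - r\<^sup>2) \<le> 2 * norm y * (1 - r\<^sup>2)"
    using g0 r by (intro mult_right_mono) (auto simp: power_le_one)
  \<comment> \<open>The previous bounds give \<open>w^2 <= r^2 + 4 * norm y * (1 - r^2)\<close>;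
    averaging with \<open>r^2\<close> halves the error term.\<close>
  moreover have "2 * (r * w) \<le> r\<^sup>2 + w\<^sup>2"
    using sum_squares_bound[of r w] by simp
  ultimately have "r * w \<le> r\<^sup>2 + 2 * norm y * (1 - r\<^sup>2)"
    by linarith
  moreover have "Re (dual_apply f (F x)) \<le> r * w"
    using complex_Re_le_cmod[of "dual_apply f (F x)"] r ru by (simp add: w_def g_def norm_divide)
  ultimately show ?thesis by (simp add: r_def)
qed

section \<open>Behaviour of the resolvent as the parameter tends to 0\<close>

text \<open>\<open>F s\<close> plays the role of the resolvent \<open>(I + s g)\<^sup>-\<^sup>1\<close>.\<close>

lemma resolvent_tendsto_on_compact:
  fixes F :: "real \<Rightarrow> 'a::complex_normed_vector \<Rightarrow> 'a"
  assumes D: "D \<subseteq> ball 0 1" "ball 0 1 \<subseteq> closure D"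
    and F: "\<forall>\<^sub>F s in at_right 0. F s \<in> Hol (ball 0 1) (ball 0 1)"
    and inv: "\<And>p. p \<in> D \<Longrightarrow> \<forall>\<^sub>F s in at_right 0. F s (p + s *\<^sub>R g p) = p"
    and K: "compact K" "K \<subseteq> cball 0 R" "R < 1"
    and e: "e > 0" and f: "norm f > 0"
  shows "\<forall>\<^sub>F s in at_right 0. \<forall>z\<in>K. norm (dual_apply f (F s z) - dual_apply f z) < e"
proof -
  define M where "M = norm f"
  have M: "M > 0" using f by (simp add: M_def)
  \<comment> \<open>Chosen so that moving a point of \<open>K\<close> by \<open>d\<close> changes
    \<open>f o F s\<close> and \<open>f\<close> by at most e/3 together;
    \<open>2 * M / (1 - R)\<close> is the Lipschitz constant on \<open>K\<close>.\<close>
  define d where "d = e / 3 / (2 * M / (1 - R) + M)"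
  have LM: "2 * M / (1 - R) > 0" using M K by simp
  then have d: "d > 0" using e M by (simp add: d_def)
  have "2 * M / (1 - R) + M \<noteq> 0" using LM M by linarith
  then have "d * (2 * M / (1 - R) + M) = e / 3"
    unfolding d_def by (rule nonzero_eq_divide_eq[THEN iffD1]) (rule refl)
  then have dd: "2 * M * d / (1 - R) + M * d = e / 3"
    by (simp add: algebra_simps)
  have "K \<subseteq> (\<Union>p\<in>D. ball p d)"
  proof
    fix z assume "z \<in> K"
    then have "z \<in> closure D" using K D by (auto simp: subset_iff)
    then obtain p where "p \<in> D" "dist p z < d" using d by (auto simp: closure_approachable)
    then show "z \<in> (\<Union>p\<in>D. ball p d)" by auto
  qed
  then obtain N where N: "N \<subseteq> D" "finite N" "K \<subseteq> (\<Union>p\<in>N. ball p d)"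
    using compactE_image[OF K(1), of D "\<lambda>p. ball p d"] by auto
  \<comment> \<open>As \<open>F s\<close> sends \<open>p + s *\<^sub>R g p\<close> back to
    \<open>p\<close>, the difference is at most a Lipschitz constant times the norm of
    \<open>s *\<^sub>R g p\<close>.\<close>
  have conv: "\<forall>\<^sub>F s in at_right 0. norm (dual_apply f (F s p) - dual_apply f p) < e / 3" if "p \<in> D" for p
  proof -
    have p: "norm p < 1" using that D by auto
    have lim: "((\<lambda>s. p + s *\<^sub>R g p) \<longlongrightarrow> p) (at_right 0)"
      by (auto intro!: tendsto_eq_intros)
    have "((\<lambda>s. 2 * M * norm (p + s *\<^sub>R g p - p) / (1 - norm p)) \<longlongrightarrow> 0) (at_right 0)"
      using p by (auto intro!: tendsto_eq_intros)
    then have "\<forall>\<^sub>F s in at_right 0. 2 * M * norm (p + s *\<^sub>R g p - p) / (1 - norm p) < e / 3"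
      by (rule order_tendstoD) (use e in simp)
    moreover have "\<forall>\<^sub>F s in at_right 0. norm (p + s *\<^sub>R g p) < 1"
      by (rule order_tendstoD(2)[OF tendsto_norm[OF lim] p])
    ultimately show ?thesis
      using F inv[OF that]
    proof eventually_elim
      case (elim s)
      then show ?case
        using Hol_ball_lipschitz[OF elim(3) f p elim(2)] by (simp add: M_def norm_minus_commute)
    qed
  qed
  have "\<forall>\<^sub>F s in at_right 0. \<forall>p\<in>N. norm (dual_apply f (F s p) - dual_apply f p) < e / 3"
    using N conv by (intro eventually_ball_finite) auto
  with F show ?thesis
  proof eventually_elim
    case (elim s)
    show ?case
    proof
      fix z assume z: "z \<in> K"
      then obtain p where p: "p \<in> N" "norm (p - z) < d" using N by (auto simp: dist_norm)
      have z1: "norm z \<le> R" "norm z < 1" using z K by auto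
      have p1: "norm p < 1" using p N D by auto
      \<comment> \<open>Centring the estimate at \<open>z\<close> instead of \<open>p\<close> keeps
        the constant uniform: \<open>norm z <= R\<close>, while \<open>p\<close> may lie outside
        \<open>cball 0 R\<close>.\<close>
      have "norm (dual_apply f (F s p) - dual_apply f (F s z)) \<le> 2 * M * norm (p - z) / (1 - norm z)"
        unfolding M_def by (rule Hol_ball_lipschitz[OF elim(1) f z1(2) p1])
      also have "\<dots> \<le> 2 * M * d / (1 - R)"
        using p z1 K M d by (intro frac_le) auto
      finally have 1: "norm (dual_apply f (F s p) - dual_apply f (F s z)) \<le> 2 * M * d / (1 - R)" .
      have "norm (dual_apply f p - dual_apply f z) \<le> M * norm (p - z)"
        using norm_dual_apply_le[of f "p - z"] by (simp add: dual_apply_diff M_def)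
      also have "\<dots> \<le> M * d" using p M by (intro mult_left_mono) auto
      finally have 2: "norm (dual_apply f p - dual_apply f z) \<le> M * d" .
      have "dual_apply f (F s z) - dual_apply f z =
         (dual_apply f (F s p) - dual_apply f p) - (dual_apply f (F s p) - dual_apply f (F s z))
         + (dual_apply f p - dual_apply f z)" by simp
      then have "norm (dual_apply f (F s z) - dual_apply f z) \<le>
         norm (dual_apply f (F s p) - dual_apply f p) + norm (dual_apply f (F s p) - dual_apply f (F s z))
         + norm (dual_apply f p - dual_apply f z)"
        by (metis norm_triangle_ineq4 norm_triangle_le add_right_mono)
      with 1 2 dd elim(2) p e show "norm (dual_apply f (F s z) - dual_apply f z) < e"
        by fastforce
    qed
  qed
qed

text \<open>The value \<open>f (F s x)\<close> is estimated twice: by expansion along the direction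
  \<open>g x\<close> up to an error \<open>s * e\<close>, and by
  \<open>Hol_ball_duality_bound\<close>. Dividing by \<open>s\<close> gives the claim up to
  \<open>e\<close>.\<close>

lemma resolvent_imp_accretive:
  fixes F :: "real \<Rightarrow> 'a::complex_normed_vector \<Rightarrow> 'a"
  assumes D: "D \<subseteq> ball 0 1" "ball 0 1 \<subseteq> closure D" "0 \<in> D"
    and F: "\<forall>\<^sub>F s in at_right 0. F s \<in> Hol (ball 0 1) (ball 0 1)"
    and inv: "\<And>p. p \<in> D \<Longrightarrow> \<forall>\<^sub>F s in at_right 0. F s (p + s *\<^sub>R g p) = p"
    and x: "x \<in> D" "x \<noteq> 0" and f: "f \<in> duality_map x"
  shows "- (2 * norm (g 0) * (1 - (norm x)\<^sup>2)) \<le> Re (dual_apply f (g x))"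
proof (rule field_le_epsilon)
  fix e :: real assume e: "e > 0"
  have x1: "norm x < 1" using x D by auto
  have fx: "dual_apply f x = of_real ((norm x)\<^sup>2)" using f by (simp add: duality_map_def)
  then have "f \<noteq> 0" using x by (auto simp: zero_dual.rep_eq)
  then have nf: "norm f > 0" by simp
  define v where "v = g x"
  \<comment> \<open>Keeps the disc \<open>x + \<zeta> *\<^sub>C v\<close> in the ball of radius
    \<open>(1 + norm x) / 2\<close>; the summand 1 avoids division by zero when
    \<open>v = 0\<close>.\<close>
  define r where "r = (1 - norm x) / 2 / (norm v + 1)"
  have nv: "norm v + 1 > 0" using norm_ge_zero[of v] by linarith
  then have r: "r > 0" using x1 by (simp add: r_def)
  have rv: "r * norm v \<le> (1 - norm x) / 2"
  proof -
    have "r * norm v \<le> r * (norm v + 1)" using r by simp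
    also have "\<dots> = (1 - norm x) / 2"
      unfolding r_def by (rule nonzero_eq_divide_eq[THEN iffD1]) (use nv in auto)
    finally show ?thesis .
  qed
  define K where "K = (\<lambda>\<zeta>. x + \<zeta> *\<^sub>C v) ` cball 0 r"
  have inK: "norm (x + \<zeta> *\<^sub>C v) \<le> (1 + norm x) / 2" if "norm \<zeta> \<le> r" for \<zeta>
  proof -
    have "norm (\<zeta> *\<^sub>C v) \<le> r * norm v" using that by (simp add: norm_scaleC mult_right_mono)
    with rv have "norm (\<zeta> *\<^sub>C v) \<le> (1 - norm x) / 2" by linarith
    with norm_triangle_ineq[of x "\<zeta> *\<^sub>C v"] show ?thesis by (simp add: field_simps)
  qed
  have K: "compact K" "K \<subseteq> cball 0 ((1 + norm x) / 2)"
  proof -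
    show "compact K" unfolding K_def
      by (intro compact_continuous_image continuous_intros
          bounded_linear.continuous_on[OF bounded_linear_scaleC_left]) auto
    show "K \<subseteq> cball 0 ((1 + norm x) / 2)" using inK by (auto simp: K_def)
  qed
  have in1: "norm (x + \<zeta> *\<^sub>C v) < 1" if "norm \<zeta> \<le> r" for \<zeta>
    using inK[OF that] x1 by simp
  \<comment> \<open>With this value the Schwarz bound \<open>2 * e' * s / r\<close> equals
    \<open>s * e\<close>.\<close>
  define e' where "e' = e * r / 2"
  have e': "e' > 0" using e r by (simp add: e'_def)
  have unif: "\<forall>\<^sub>F s in at_right 0. \<forall>z\<in>K. norm (dual_apply f (F s z) - dual_apply f z) < e'"
    by (rule resolvent_tendsto_on_compact[OF D(1,2) F inv K _ e' nf]) (use x1 in auto)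
  have "((\<lambda>s. s *\<^sub>R g 0) \<longlongrightarrow> 0) (at_right 0)" by (auto intro!: tendsto_eq_intros)
  from order_tendstoD(2)[OF tendsto_norm[OF this], of 1]
  have "\<forall>\<^sub>F s in at_right 0. norm (s *\<^sub>R g 0) < 1" by simp
  moreover have "\<forall>\<^sub>F s in at_right 0. s \<in> {0<..<r}"
    by (rule eventually_at_right_real[OF r])
  ultimately have "\<forall>\<^sub>F s in at_right 0.
      0 < s \<and> s * - (2 * norm (g 0) * (1 - (norm x)\<^sup>2)) \<le> s * (Re (dual_apply f (g x)) + e)"
    using unif F inv[OF x(1)] inv[OF D(3)]
  proof eventually_elim
    case (elim s)
    have s: "0 < s" "s < r" using elim by auto
    \<comment> \<open>At \<open>s\<close> the first term is \<open>dual_apply f x\<close> by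
      inversion, so \<open>k s - k 0\<close> is the first-order remainder.\<close>
    define k where "k \<zeta> = dual_apply f (F s (x + \<zeta> *\<^sub>C v)) - dual_apply f (x + \<zeta> *\<^sub>C v)" for \<zeta>
    have "norm (k (of_real s) - k 0) \<le> 2 * e' * norm (complex_of_real s) / r"
    proof (rule Schwarz_diff_bound)
      have "(\<lambda>\<zeta>. dual_apply f (F s (x + \<zeta> *\<^sub>C v))) holomorphic_on ball 0 r"
        by (rule Hol_along_line[OF elim(4)]) (use in1 in auto)
      then show "k holomorphic_on ball 0 r"
        unfolding k_def dual_apply_add dual_apply_scaleC by (intro holomorphic_intros) auto
      show "norm (k z) < e'" if "norm z < r" for z
        using elim(3) that by (auto simp: k_def K_def)
    qed (use s in auto)
    then have "norm (k (of_real s) - k 0) \<le> s * e"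
      using s r by (simp add: e'_def mult.commute)
    moreover have "k (of_real s) - k 0 = dual_apply f x - dual_apply f (F s x) - of_real s * dual_apply f v"
      using elim(5) by (simp add: k_def dual_apply_add dual_apply_scaleC v_def flip: scaleC_of_real)
    ultimately have "Re (dual_apply f x - dual_apply f (F s x) - of_real s * dual_apply f v) \<le> s * e"
      using complex_Re_le_cmod order_trans by metis
    then have "(norm x)\<^sup>2 - Re (dual_apply f (F s x)) \<le> s * (Re (dual_apply f v) + e)"
      by (simp add: fx algebra_simps)
    \<comment> \<open>The zero of \<open>F s\<close> is \<open>s *\<^sub>R g 0\<close>, by inversion
      at the origin.\<close>
    moreover have "Re (dual_apply f (F s x)) \<le> (norm x)\<^sup>2 + 2 * norm (s *\<^sub>R g 0) * (1 - (norm x)\<^sup>2)"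
      by (rule Hol_ball_duality_bound[OF elim(4) f x(2) x1 elim(1)]) (use elim(6) in simp)
    ultimately show ?case
      using s by (simp add: v_def algebra_simps)
  qed
  then obtain s where "0 < s"
      "s * - (2 * norm (g 0) * (1 - (norm x)\<^sup>2)) \<le> s * (Re (dual_apply f (g x)) + e)"
    using eventually_happens'[OF trivial_limit_at_right_real] by blast
  then show "- (2 * norm (g 0) * (1 - (norm x)\<^sup>2)) \<le> Re (dual_apply f (g x)) + e"
    by (metis mult_le_cancel_left_pos)
qed

section \<open>Abel averages as resolvents, and dissipativity\<close>

lemma abel_average_eqI:
  assumes "\<exists>!y. abel_solution D h \<omega> \<alpha> x y" "abel_solution D h \<omega> \<alpha> x y" "\<alpha> \<noteq> 0"
  shows "abel_average D h \<omega> \<alpha> x = y"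
  using assms by (auto simp: abel_average_def intro: the1_equality)

theorem theorem1p7:
  fixes D :: "'a::complex_banach set"
    and h :: "'a \<Rightarrow> 'a"
    and \<omega> :: real
  assumes "D \<subseteq> ball 0 1"
    and "ball 0 1 \<subseteq> closure D"
    and "balanced D"
    and "pseudo_contractive \<omega> D h"
    and "weakly_closed_map D h"
    and "reflexive_space TYPE('a) \<or>
      (weakly_sequentially_complete TYPE('a) \<and>
        (\<forall>x\<in>D. bounded (h ` {\<zeta> *\<^sub>C x | \<zeta>. cmod \<zeta> < 1})))"
  shows "dissipative \<omega> D h"
proof -
  obtain p where "p \<in> D" using assms(2) by fastforce
  then have "0 *\<^sub>C p \<in> D" using assms(3) by (metis balanced_def norm_zero zero_le_one)
  then have D0: "0 \<in> D" by simp
  obtain \<delta> where \<delta>: "\<delta> > 0" and pc: "\<And>\<alpha>. \<alpha> \<in> {0<..<\<delta>} \<Longrightarrow>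
      (\<forall>x\<in>ball 0 1. \<exists>!y. abel_solution D h \<omega> \<alpha> x y) \<and> abel_average D h \<omega> \<alpha> \<in> Hol (ball 0 1) D"
    using assms(4) unfolding pseudo_contractive_def by blast
  \<comment> \<open>Inverse of the substitution s = \<alpha> / (1 - \<alpha>\<omega>), so that
    \<open>1 - a s * \<omega> = 1 / (1 + s * \<omega>)\<close>.\<close>
  define a where "a s = s / (1 + s * \<omega>)" for s
  define g where "g x = \<omega> *\<^sub>R x - h x" for x
  have "((\<lambda>s. 1 + s * \<omega>) \<longlongrightarrow> 1) (at_right 0)" "(a \<longlongrightarrow> 0) (at_right 0)"
    unfolding a_def by (auto intro!: tendsto_eq_intros)
  then have "\<forall>\<^sub>F s in at_right 0. 1 + s * \<omega> > 0" "\<forall>\<^sub>F s in at_right 0. a s < \<delta>"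
    using \<delta> by (auto dest: order_tendstoD(2) elim: order_tendstoD(1)[OF _ zero_less_one])
  with eventually_at_right_less[of 0]
  have small: "\<forall>\<^sub>F s in at_right 0. 1 + s * \<omega> > 0 \<and> a s \<in> {0<..<\<delta>}"
    by eventually_elim (auto simp: a_def)
  have F: "\<forall>\<^sub>F s in at_right 0. abel_average D h \<omega> (a s) \<in> Hol (ball 0 1) (ball 0 1)"
    using small by eventually_elim (use pc Hol_mono[OF _ assms(1)] in blast)
  have inv: "\<forall>\<^sub>F s in at_right 0. abel_average D h \<omega> (a s) (p + s *\<^sub>R g p) = p" if p: "p \<in> D" for p
  proof -
    have "norm p < 1" using p assms(1) by auto
    moreover have "((\<lambda>s. norm (p + s *\<^sub>R g p)) \<longlongrightarrow> norm p) (at_right 0)"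
      by (auto intro!: tendsto_eq_intros)
    ultimately have "\<forall>\<^sub>F s in at_right 0. norm (p + s *\<^sub>R g p) < 1"
      by (auto dest: order_tendstoD)
    with small show ?thesis
    proof eventually_elim
      case (elim s)
      have eq: "1 - a s * \<omega> = 1 / (1 + s * \<omega>)"
        using elim by (simp add: a_def field_simps)
      have "(1 - a s * \<omega>) *\<^sub>R (p + s *\<^sub>R g p) = (1 / (1 + s * \<omega>)) *\<^sub>R ((1 + s * \<omega>) *\<^sub>R p - s *\<^sub>R h p)"
        unfolding eq by (simp add: g_def algebra_simps)
      also have "\<dots> = p - a s *\<^sub>R h p"
        using elim by (simp add: a_def scaleR_diff_right)
      finally have "abel_solution D h \<omega> (a s) (p + s *\<^sub>R g p) p"
        using p by (simp add: abel_solution_def)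
      then show ?case
        using elim pc[of "a s"] by (intro abel_average_eqI) auto
    qed
  qed
  have "Re (dual_apply f (h x)) \<le> \<omega> * (norm x)\<^sup>2 + 2 * norm (h 0) * (1 - (norm x)\<^sup>2)"
    if x: "x \<in> D" "x \<noteq> 0" "f \<in> duality_map x" for x f
  proof -
    have "dual_apply f (\<omega> *\<^sub>R x) = of_real (\<omega> * (norm x)\<^sup>2)"
      using x(3) by (simp add: duality_map_def dual_apply_scaleC flip: scaleC_of_real)
    then have "Re (dual_apply f (g x)) = \<omega> * (norm x)\<^sup>2 - Re (dual_apply f (h x))"
      by (simp add: g_def dual_apply_diff)
    with resolvent_imp_accretive[where g=g, OF assms(1,2) D0 F inv x] show ?thesis
      by (simp add: g_def)
  qed
  then show ?thesis
    \<comment> \<open>Taking \<epsilon> = 1 leaves exactly the nonzero points of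
      \<open>D\<close>.\<close>
    unfolding dissipative_def by (intro exI[of _ 1] conjI exI[of _ "2 * norm (h 0)"]) auto
qed

end
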